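(* Let $D$ be a digraph of order $n \geq 4$ and let $Y \subseteq V(D)$ be a set of vertices with $|Y| \geq 2$. Suppose that $D$ is $Y$-strongly connected, i.e. for every pair of distinct vertices $x, y \in Y$ there is a directed path from $x$ to $y$ and a directed path from $y$ to $x$ in $D$. Suppose further that $Y$ satisfies the following condition: for every triple of distinct vertices $x, y, z \in Y$ such that $x$ and $y$ are nonadjacent, (1) if $xz \notin A(D)$, then $d(x) + d(y) + d^+(x) + d^-(z) \geq 3n-2$; and (2) if $zx \notin A(D)$, then $d(x) + d(y) + d^-(x) + d^+(z) \geq 3n-2$. Then $D$ contains a directed cycle that passes through all the vertices of $Y$ except possibly one; that is, there is a directed cycle $C$ in $D$ with $|Y \setminus V(C)| \leq 1$.
   Context: Digraphs are finite, without loops and without multiple arcs (a pair of opposite arcs $xy$, $yx$ is allowed). $V(D)$ and $A(D)$ denote the vertex set and the arc set of $D$; the order of $D$ is $|V(D)|$; $xy$ denotes the arc directed from $x$ to $y$. Two distinct vertices $x,y$ are adjacent if $xy \in A(D)$ or $yx \in A(D)$ (or both), and nonadjacent otherwise. $d^+(x)$ and $d^-(x)$ are the out-degree and the in-degree of $x$ in $D$, and $d(x) = d^+(x) + d^-(x)$. A directed cycle consists of distinct vertices $x_1, \ldots, x_m$ with $m \geq 2$ and the arcs $x_i x_{i+1}$ ($1 \leq i \leq m-1$) and $x_m x_1$; in particular cycles of length two are allowed. Directed paths have distinct vertices. All paths and cycles are directed, and the paths in the definition of $Y$-strong connectivity may use vertices outside $Y$. *)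

theory Defs
  imports "Graph_Theory.Digraph" "Graph_Theory.Arc_Walk"
begin

definition degree :: "('a, 'b) pre_digraph \<Rightarrow> 'a \<Rightarrow> nat" where
  "degree D x = out_degree D x + in_degree D x"

definition adjacent :: "('a, 'b) pre_digraph \<Rightarrow> 'a \<Rightarrow> 'a \<Rightarrow> bool" where
  "adjacent D x y \<longleftrightarrow> x \<rightarrow>\<^bsub>D\<^esub> y \<or> y \<rightarrow>\<^bsub>D\<^esub> x"

text \<open>The connecting paths may leave \<open>Y\<close>. Swapping \<open>x\<close> and \<open>y\<close> yields the path
  in the other direction.\<close>

definition strongly_connected_set :: "('a, 'b) pre_digraph \<Rightarrow> 'a set \<Rightarrow> bool" where
  "strongly_connected_set D Y \<longleftrightarrow>
     (\<forall>x\<in>Y. \<forall>y\<in>Y. x \<noteq> y \<longrightarrow> (\<exists>p. pre_digraph.apath D x p y))"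

definition degree_condition :: "('a, 'b) pre_digraph \<Rightarrow> 'a set \<Rightarrow> bool" where
  "degree_condition D Y \<longleftrightarrow>
     (\<forall>x\<in>Y. \<forall>y\<in>Y. \<forall>z\<in>Y.
        x \<noteq> y \<and> x \<noteq> z \<and> y \<noteq> z \<and> \<not> adjacent D x y \<longrightarrow>
          (\<not> x \<rightarrow>\<^bsub>D\<^esub> z \<longrightarrow>
             degree D x + degree D y + out_degree D x + in_degree D z
               \<ge> 3 * card (verts D) - 2) \<and>
          (\<not> z \<rightarrow>\<^bsub>D\<^esub> x \<longrightarrow>
             degree D x + degree D y + in_degree D x + out_degree D z
               \<ge> 3 * card (verts D) - 2))"

text \<open>A cycle is a nonempty closed list of arcs, so its vertices are exactly the tails of
  its arcs. In a loop-free digraph every cycle has length at least two, and the cycles of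
  length two are precisely the pairs of opposite arcs.\<close>

definition cycle_verts :: "('a, 'b) pre_digraph \<Rightarrow> 'b list \<Rightarrow> 'a set" where
  "cycle_verts D c = tail D ` set c"

lemma cycle_verts_eq_awalk_verts:
  assumes "pre_digraph.awalk D u c u" "c \<noteq> []"
  shows "cycle_verts D c = set (pre_digraph.awalk_verts D u c)"
proof -
  interpret pre_digraph D .
  from assms have cas: "cas u c u" by (simp add: awalk_def)
  have "set (awalk_verts u c) = insert v (tail D ` set c)" if "cas u c v" for v
    using that by (induction c arbitrary: u) auto
  from this[OF cas] show ?thesis
    using cas assms(2) by (cases c) (auto simp: cycle_verts_def)
qed

lemma (in loopfree_digraph) cycle_length_ge_2:
  assumes "cycle c"
  shows "length c \<ge> 2"
proof (rule ccontr)
  assume "\<not> length c \<ge> 2"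
  with assms obtain e where "c = [e]"
    unfolding cycle_def by (cases c) (auto simp: not_le less_Suc_eq numeral_2_eq_2)
  with assms no_loops[of e] show False
    by (auto simp: cycle_def awalk_def)
qed

end

theory Submission
  imports Defs
begin

text \<open>One may pass to the strong component of \<open>Y\<close>: a vertex outside it contributes at most three
  to the left-hand side of each condition. Call nonadjacent \<open>x, y \<in> Y\<close> bad partners if
  \<open>d(x) + d(y) \<le> 2n - 2\<close>. By the hypothesis the bad pairs form a matching, and for a bad pair
  \<open>x, y\<close> and a third \<open>z \<in> Y\<close> a missing arc \<open>xz\<close> forces \<open>d\<^sup>+(x) + d\<^sup>-(z) \<ge> n\<close>, and likewise
  for a missing arc \<open>zx\<close>.

  Let \<open>C\<close> be a cycle through as many vertices of \<open>Y\<close> as possible. As in the proof of Meyniel's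
  theorem, an ear of \<open>C\<close> through \<open>y \<in> Y - C\<close> with a minimal gap yields a bad partner of \<open>y\<close>
  inside the gap, and this partner can be exchanged with \<open>y\<close>; if there were no ear
  through \<open>y\<close>, then all of \<open>Y \<inter> C\<close> would be bad partners of \<open>y\<close>. So if \<open>C\<close> misses \<open>y\<^sub>1\<close> and
  \<open>y\<^sub>2\<close>, they have distinct bad partners \<open>x\<^sub>1\<close> and \<open>x\<^sub>2\<close> on \<open>C\<close>, and no ear through \<open>y\<^sub>i\<close>
  ends in \<open>x\<^sub>i\<close>. An arc \<open>y\<^sub>1y\<^sub>2\<close> excludes the arcs \<open>y\<^sub>2x\<^sub>1\<close>, \<open>x\<^sub>2y\<^sub>1\<close> and \<open>y\<^sub>2y\<^sub>1\<close> and forces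
  \<open>x\<^sub>1y\<^sub>2\<close> or \<open>y\<^sub>1x\<^sub>2\<close>; the resulting degree bounds provide common neighbours outside \<open>C\<close> that
  close up an ear from \<open>x\<^sub>1\<close> to \<open>x\<^sub>2\<close> through \<open>y\<^sub>1\<close>, a contradiction. If \<open>y\<^sub>1\<close> and \<open>y\<^sub>2\<close> are nonadjacent,
  the degree sum of the two bad pairs forces an arc between \<open>x\<^sub>1\<close> and \<open>y\<^sub>2\<close> or between \<open>x\<^sub>2\<close> and
  \<open>y\<^sub>1\<close>, and an exchange reduces to the previous case.\<close>

section \<open>Lists and paths\<close>

lemma not_successively_split:
  assumes "\<not> successively R q"
  obtains u a b w where "q = u @ a # b # w" "\<not> R a b"
proof -
  have "\<exists>u a b w. q = u @ a # b # w \<and> \<not> R a b"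
    using assms
  proof (induction R q rule: successively.induct)
    case (3 P x y xs)
    show ?case
    proof (cases "P x y")
      case True
      with 3 obtain u a b w where "y # xs = u @ a # b # w" "\<not> P a b" by auto
      then have "x # y # xs = (x # u) @ a # b # w" by simp
      with \<open>\<not> P a b\<close> show ?thesis by blast
    next
      case False
      have "x # y # xs = [] @ x # y # xs" by simp
      with False show ?thesis by blast
    qed
  qed auto
  with that show ?thesis by blast
qed

text \<open>Each of the \<open>length q - 1\<close> consecutive pairs contributes at most one, and
  only \<open>S (hd q)\<close> and \<open>P (last q)\<close> belong to no pair. With
  \<open>P\<close> and \<open>S\<close> as arcs into and out of \<open>x\<close>, this bounds the
  arcs between \<open>x\<close> and a path that cannot absorb \<open>x\<close>.\<close>

lemma successively_count:
  assumes "successively (\<lambda>u v. \<not> (P u \<and> S v)) q" "q \<noteq> []" "distinct q"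
  shows "(\<Sum>v\<in>set q. of_bool (P v) + of_bool (S v)) + 1
    \<le> length q + of_bool (S (hd q)) + (of_bool (P (last q)) :: nat)"
  using assms
proof (induction q rule: induct_list012)
  case (3 x y zs)
  have "(\<Sum>v\<in>set (y # zs). of_bool (P v) + of_bool (S v)) + 1
    \<le> length (y # zs) + of_bool (S (hd (y # zs))) + (of_bool (P (last (y # zs))) :: nat)"
    using 3 by auto
  moreover have "of_bool (P x) + of_bool (S y) \<le> (1 :: nat)"
    using 3 by (auto simp: of_bool_def)
  moreover have "(\<Sum>v\<in>set (x # y # zs). of_bool (P v) + of_bool (S v))
     = (of_bool (P x) + of_bool (S x) :: nat) + (\<Sum>v\<in>set (y # zs). of_bool (P v) + of_bool (S v))"
    using 3 by (subst list.set(2), subst sum.insert) auto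
  ultimately show ?case by simp
qed auto

lemma rtranclp_imp_successively:
  assumes "E\<^sup>*\<^sup>* x y" "x \<noteq> y"
  shows "\<exists>p. successively E (x # p @ [y])"
  using assms
proof (induction rule: converse_rtranclp_induct)
  case (step u v)
  show ?case
  proof (cases "v = y")
    case True
    with step have "successively E (u # [] @ [y])" by simp
    then show ?thesis by blast
  next
    case False
    with step obtain p where "successively E (v # p @ [y])" by auto
    with step have "successively E (u # (v # p) @ [y])" by simp
    then show ?thesis by blast
  qed
qed auto

text \<open>The walk is shortest over all starting points in \<open>K\<close>, and a violation of
  any listed property would allow a shortcut. Even distinctness is not imposed but derived in this
  way.\<close>

lemma shortest_path_from_set:
  assumes "E\<^sup>*\<^sup>* k y" "k \<in> K" "y \<notin> K"
  obtains a p where "a \<in> K" "successively E (a # p @ [y])" "distinct p" "set p \<inter> K = {}" "y \<notin> set p"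
    "\<forall>u v w. p = u @ v # w \<longrightarrow> E v y \<longrightarrow> w = []"
    "\<forall>u v w. \<forall>x\<in>K. p = u @ v # w \<longrightarrow> E x v \<longrightarrow> u = []"
proof -
  define W where "W p \<longleftrightarrow> (\<exists>a\<in>K. successively E (a # p @ [y]))" for p
  have "k \<noteq> y" using assms by auto
  with rtranclp_imp_successively[OF assms(1)] assms(2) have "\<exists>p. W p"
    unfolding W_def by blast
  then obtain p where p: "W p" and min: "\<And>p'. W p' \<Longrightarrow> length p \<le> length p'"
    using ex_has_least_nat[of W _ length] by blast
  from p obtain a where a: "a \<in> K" "successively E (a # p @ [y])" unfolding W_def by blast
  have last: "w = []" if "p = u @ v # w" "E v y" for u v w
  proof -
    have "successively E (a # (u @ [v]) @ [y])"
      using a that by (auto simp: successively_append_iff successively_Cons hd_append)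
    then have "W (u @ [v])" using a unfolding W_def by blast
    from min[OF this] that show ?thesis by simp
  qed
  have first: "u = []" if "p = u @ v # w" "x \<in> K" "E x v" for u v w x
  proof -
    have "successively E (x # (v # w) @ [y])"
      using a that by (cases w) (auto simp: successively_append_iff successively_Cons)
    then have "W (v # w)" using that unfolding W_def by blast
    from min[OF this] that show ?thesis by simp
  qed
  have "v \<notin> K" if "v \<in> set p" for v
  proof
    assume "v \<in> K"
    from that obtain u w where uw: "p = u @ v # w" by (auto simp: in_set_conv_decomp)
    then have "successively E (v # w @ [y])"
      using a by (auto simp: successively_append_iff successively_Cons hd_append split: if_splits)
    then have "W w" using \<open>v \<in> K\<close> unfolding W_def by blast
    from min[OF this] uw show False by simp
  qed
  moreover have "y \<notin> set p"
  proof
    assume "y \<in> set p"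
    then obtain u w where uw: "p = u @ y # w" by (auto simp: in_set_conv_decomp)
    then have "successively E (a # u @ [y])"
      using a by (auto simp: successively_append_iff successively_Cons hd_append split: if_splits)
    then have "W u" using a unfolding W_def by blast
    from min[OF this] uw show False by simp
  qed
  moreover have "distinct p"
  proof (rule ccontr)
    assume "\<not> distinct p"
    then obtain u v t w where uw: "p = u @ [v] @ t @ [v] @ w"
      using not_distinct_decomp by blast
    then have "successively E (a # (u @ [v] @ w) @ [y])"
      using a by (auto simp: successively_append_iff successively_Cons hd_append split: if_splits)
    then have "W (u @ [v] @ w)" using a unfolding W_def by blast
    from min[OF this] uw show False by simp
  qed
  ultimately show ?thesis
    by (intro that[OF a]) (use last first in blast)+
qed

section \<open>Ears\<close>

locale strong_digraph =
  fixes V :: "'a set" and E :: "'a \<Rightarrow> 'a \<Rightarrow> bool"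
  assumes finite_V: "finite V"
    and arc_in_V: "E u v \<Longrightarrow> u \<in> V \<and> v \<in> V"
    and no_loop: "\<not> E u u"
    and strong: "u \<in> V \<Longrightarrow> v \<in> V \<Longrightarrow> E\<^sup>*\<^sup>* u v"
begin

definition outd :: "'a \<Rightarrow> nat" where "outd x = card {v. E x v}"
definition ind :: "'a \<Rightarrow> nat" where "ind x = card {v. E v x}"
definition deg :: "'a \<Rightarrow> nat" where "deg x = outd x + ind x"

definition adj :: "'a \<Rightarrow> 'a \<Rightarrow> bool" where "adj x y \<longleftrightarrow> E x y \<or> E y x"

text \<open>The ends \<open>a\<close> and \<open>b\<close> may coincide, so an ear can be a cycle that meets \<open>K\<close> once.\<close>

definition ear :: "'a set \<Rightarrow> 'a \<Rightarrow> 'a list \<Rightarrow> 'a \<Rightarrow> bool" where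
  "ear K a p b \<longleftrightarrow> a \<in> K \<and> b \<in> K \<and> distinct p \<and> set p \<inter> K = {} \<and> successively E (a # p @ [b])"

lemma finite_out: "finite {v. E x v}" and finite_in: "finite {v. E v x}"
  by (rule finite_subset[OF _ finite_V], use arc_in_V in blast)+

lemma outd_sum: "outd x = (\<Sum>v\<in>V. of_bool (E x v))"
  and ind_sum: "ind x = (\<Sum>v\<in>V. of_bool (E v x))"
proof -
  have "{v. E x v} = V \<inter> {v. E x v}" "{v. E v x} = V \<inter> {v. E v x}" using arc_in_V by auto
  then show "outd x = (\<Sum>v\<in>V. of_bool (E x v))" "ind x = (\<Sum>v\<in>V. of_bool (E v x))"
    unfolding outd_def ind_def using finite_V by (simp_all add: sum_of_bool_eq)
qed

abbreviation link :: "'a \<Rightarrow> 'a \<Rightarrow> nat" where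
  "link x v \<equiv> of_bool (E v x) + of_bool (E x v)"

lemma deg_sum: "deg x = (\<Sum>v\<in>V. link x v)"
  unfolding deg_def outd_sum ind_sum by (simp add: sum.distrib)

text \<open>Neither \<open>x\<close> nor \<open>y\<close> contributes to the degree sum, which saves
  \<open>4\<close> against two arcs per vertex; \<open>f\<close> collects the excess at the other
  vertices.\<close>

lemma deg_add_le:
  assumes "x \<in> V" "y \<in> V" "x \<noteq> y" "\<not> adj x y"
    and le: "\<And>v. v \<in> V - {x, y} \<Longrightarrow> link x v + link y v \<le> 2 + f v"
  shows "deg x + deg y + 4 \<le> 2 * card V + sum f (V - {x, y})"
proof -
  have "deg x + deg y = (\<Sum>v\<in>V. link x v + link y v)"
    unfolding deg_sum by (simp add: sum.distrib)
  also have "\<dots> = (\<Sum>v\<in>V - {x, y}. link x v + link y v) + (\<Sum>v\<in>{x, y}. link x v + link y v)"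
    using assms by (intro sum.subset_diff finite_V) auto
  also have "(\<Sum>v\<in>{x, y}. link x v + link y v) = 0"
    using assms no_loop by (auto simp: adj_def)
  also have "(\<Sum>v\<in>V - {x, y}. link x v + link y v) \<le> (\<Sum>v\<in>V - {x, y}. 2 + f v)"
    by (intro sum_mono le)
  also have "\<dots> = 2 * card (V - {x, y}) + sum f (V - {x, y})"
    by (simp add: sum.distrib del: add_2_eq_Suc add_2_eq_Suc')
  finally have "deg x + deg y \<le> 2 * card (V - {x, y}) + sum f (V - {x, y})" by simp
  moreover have "card (V - {x, y}) + card {x, y} = card V"
    using assms finite_V by (metis card_Diff_subset card_mono finite.emptyI finite.insertI empty_subsetI insert_subset le_add_diff_inverse2)
  ultimately show ?thesis using assms by auto
qed

text \<open>Every \<open>v\<close> with arcs \<open>yv\<close> and \<open>vx\<close> lies on a shortest path from \<open>K\<close> to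
  \<open>y\<close>; a third arc between \<open>v\<close> and \<open>{x, y}\<close> forces \<open>v\<close> to be an end of the interior of that path.\<close>

lemma no_ear_no_in_link:
  assumes "K \<subseteq> V" "x \<in> K" "y \<in> V - K" "\<And>v. v \<in> K \<Longrightarrow> \<not> adj v y"
    and no_ear: "\<And>a p b. ear K a p b \<Longrightarrow> y \<notin> set p"
    and no_link: "\<And>v. E x v \<Longrightarrow> \<not> E v y"
  shows "deg x + deg y + 2 \<le> 2 * card V"
proof -
  have "E\<^sup>*\<^sup>* x y" "y \<notin> K" using assms strong by auto
  obtain a p where
    p: "a \<in> K" "successively E (a # p @ [y])" "distinct p" "set p \<inter> K = {}" "y \<notin> set p" and
    pl: "\<forall>u v w. p = u @ v # w \<longrightarrow> E v y \<longrightarrow> w = []" and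
    pf: "\<forall>u v w. \<forall>x\<in>K. p = u @ v # w \<longrightarrow> E x v \<longrightarrow> u = []"
    by (rule shortest_path_from_set[OF \<open>E\<^sup>*\<^sup>* x y\<close> assms(2) \<open>y \<notin> K\<close>])
  \<comment> \<open>Only the ends of \<open>p\<close> may have more than two arcs to and from
    \<open>x\<close> and \<open>y\<close>. For \<open>p = []\<close> these ends are unspecified, but
    the total of \<open>f\<close> stays at most two.\<close>
  define f :: "'a \<Rightarrow> nat" where "f v = of_bool (v = last p) + of_bool (v = hd p)" for v
  have in_p: "v \<in> set p" if "E y v" "E v x" for v
  proof (rule ccontr)
    assume "v \<notin> set p"
    moreover have "v \<notin> K" using assms that by (auto simp: adj_def)
    moreover have "v \<noteq> y" using that no_loop by auto
    ultimately have "ear K a (p @ [y, v]) x"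
      using p that assms(2,3) by (auto simp: ear_def successively_append_iff successively_Cons hd_append)
    then show False using no_ear by fastforce
  qed
  have xy: "x \<in> V" "y \<in> V" "x \<noteq> y" "\<not> adj x y" using assms by auto
  have "link x v + link y v \<le> 2 + f v" if "v \<in> V - {x, y}" for v
  proof (cases "E y v \<and> E v x")
    case True
    then obtain u w where uw: "p = u @ v # w" using in_p by (meson in_set_conv_decomp)
    have "v = last p" if "E v y"
    proof -
      have "w = []" using pl uw that by blast
      then show ?thesis using uw by simp
    qed
    moreover have "v = hd p" if "E x v"
    proof -
      have "u = []" using pf assms(2) uw that by blast
      then show ?thesis using uw by simp
    qed
    ultimately show ?thesis using True no_link[of v] unfolding f_def by (cases "E v y"; cases "E x v") auto
  next
    case False
    with no_link[of v] show ?thesis by (auto simp: of_bool_def)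
  qed
  then have "deg x + deg y + 4 \<le> 2 * card V + sum f (V - {x, y})"
    by (rule deg_add_le[OF xy])
  also have "sum f (V - {x, y}) \<le> sum f V"
    by (intro sum_mono2) (auto simp: finite_V)
  also have "\<dots> \<le> 2"
    using finite_V by (auto simp: f_def sum.distrib of_bool_def sum.delta)
  finally show ?thesis by simp
qed

text \<open>Reversing all arcs turns ears into ears and exchanges the two kinds of links between
  \<open>x\<close> and \<open>y\<close>.\<close>

lemma no_ear_no_out_link:
  assumes K: "K \<subseteq> V" "x \<in> K" and y: "y \<in> V - K" and nonadj: "\<And>v. v \<in> K \<Longrightarrow> \<not> adj v y"
    and no_ear: "\<And>a p b. ear K a p b \<Longrightarrow> y \<notin> set p"
    and no_link: "\<And>v. E y v \<Longrightarrow> \<not> E v x"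
  shows "deg x + deg y + 2 \<le> 2 * card V"
proof -
  have "(\<lambda>x y. E y x) = E\<inverse>\<inverse>" by auto
  then interpret rev: strong_digraph V "\<lambda>x y. E y x"
    using finite_V arc_in_V no_loop strong
    by unfold_locales (auto simp: rtranclp_conversep)
  have deg: "rev.deg v = deg v" for v
    by (simp add: rev.deg_def deg_def rev.outd_def ind_def rev.ind_def outd_def)
  have ear: "ear K b (rev p) a" if "rev.ear K a p b" for a p b
    using that successively_rev[of E "a # p @ [b]"] by (auto simp: rev.ear_def ear_def)
  have "y \<notin> set p" if "rev.ear K a p b" for a p b
    using no_ear[OF ear[OF that]] by simp
  moreover have "\<not> rev.adj v y" if "v \<in> K" for v
    using nonadj[OF that] by (auto simp: rev.adj_def adj_def)
  ultimately have "rev.deg x + rev.deg y + 2 \<le> 2 * card V"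
    using no_link by (intro rev.no_ear_no_in_link[OF K y]) blast+
  then show ?thesis unfolding deg .
qed

text \<open>A vertex of \<open>K\<close> adjacent to \<open>y\<close> would close an ear with a path
  from \<open>y\<close> to \<open>K\<close> or from \<open>K\<close> to \<open>y\<close>. If links
  from \<open>x\<close> to \<open>y\<close> and back both exist, two distinct middle vertices would
  give an ear from \<open>x\<close> to \<open>x\<close>; so all links share one vertex, whose excess
  is at most two.\<close>

lemma no_ear:
  assumes K: "K \<subseteq> V" "x \<in> K" and y: "y \<in> V - K"
    and no_ear: "\<And>a p b. ear K a p b \<Longrightarrow> y \<notin> set p"
  shows "\<not> adj x y" "deg x + deg y + 2 \<le> 2 * card V"
proof -
  have xy: "E\<^sup>*\<^sup>* x y" "E\<inverse>\<inverse>\<^sup>*\<^sup>* x y"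
    using assms strong by (auto simp: rtranclp_conversep)
  have "y \<notin> K" using y by simp
  obtain a p where
    p: "a \<in> K" "successively E (a # p @ [y])" "distinct p" "set p \<inter> K = {}" "y \<notin> set p"
    by (rule shortest_path_from_set[OF xy(1) K(2) \<open>y \<notin> K\<close>])
  obtain b q where
    q: "b \<in> K" "successively E\<inverse>\<inverse> (b # q @ [y])" "distinct q" "set q \<inter> K = {}" "y \<notin> set q"
    by (rule shortest_path_from_set[OF xy(2) K(2) \<open>y \<notin> K\<close>])
  have q': "successively E (y # rev q @ [b])"
    using q(2) successively_rev[of E "b # q @ [y]"] by (simp add: conversep_iff[abs_def])
  have nonadj: "\<not> adj v y" if "v \<in> K" for v
  proof
    assume "adj v y"
    then consider "E v y" | "E y v" by (auto simp: adj_def)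
    then show False
    proof cases
      case 1
      then have "ear K v (y # rev q) b" using q q' y that by (auto simp: ear_def)
      then show False using no_ear by fastforce
    next
      case 2
      then have "ear K a (p @ [y]) v"
        using p y that by (auto simp: ear_def successively_append_iff successively_Cons hd_append)
      then show False using no_ear by fastforce
    qed
  qed
  then show "\<not> adj x y" using K by blast
  have eq: "v = w" if "E x v" "E v y" "E y w" "E w x" for v w
  proof (rule ccontr)
    assume "v \<noteq> w"
    have "v \<notin> K" "w \<notin> K" using that nonadj by (auto simp: adj_def)
    then have "ear K x [v, y, w] x"
      using that \<open>v \<noteq> w\<close> K y no_loop by (auto simp: ear_def)
    then show False using no_ear by fastforce
  qed
  consider (I) "\<And>v. E x v \<Longrightarrow> \<not> E v y" | (O) "\<And>v. E y v \<Longrightarrow> \<not> E v x"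
    | (both) v w where "E x v" "E v y" "E y w" "E w x" by blast
  then show "deg x + deg y + 2 \<le> 2 * card V"
  proof cases
    case I
    show ?thesis by (rule no_ear_no_in_link[OF K y nonadj no_ear I])
  next
    case O
    show ?thesis by (rule no_ear_no_out_link[OF K y nonadj no_ear O])
  next
    case (both u w)
    with eq have "u = w" by blast
    have "link x v + link y v \<le> 2 + 2 * of_bool (v = u)" for v
    proof (cases "v = u")
      case False
      then have "\<not> (E x v \<and> E v y)" "\<not> (E y v \<and> E v x)"
        using eq both \<open>u = w\<close> by blast+
      then show ?thesis by (auto simp: of_bool_def)
    qed (simp add: of_bool_def)
    then have "deg x + deg y + 4 \<le> 2 * card V + (\<Sum>v\<in>V - {x, y}. 2 * of_bool (v = u))"
      using K y nonadj by (intro deg_add_le[OF _ _ _ nonadj]) (blast | assumption)+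
    also have "(\<Sum>v\<in>V - {x, y}. 2 * of_bool (v = u)) \<le> (\<Sum>v\<in>V. 2 * of_bool (v = u) :: nat)"
      by (intro sum_mono2) (auto simp: finite_V)
    also have "\<dots> \<le> 2"
      using finite_V by (auto simp: of_bool_def if_distrib sum.delta cong: if_cong)
    finally show ?thesis by simp
  qed
qed

end

section \<open>Maximal cycles and minimal ears\<close>

context strong_digraph
begin

text \<open>Single vertices count as cycles, so that a maximal cycle always exists.\<close>

definition cyc :: "'a list \<Rightarrow> bool" where
  "cyc c \<longleftrightarrow> c \<noteq> [] \<and> distinct c \<and> set c \<subseteq> V \<and> successively E c \<and> (length c = 1 \<or> E (last c) (hd c))"

lemma cyc_rotate: "cyc (xs @ ys) \<Longrightarrow> cyc (ys @ xs)"
  by (cases "xs = []"; cases "ys = []") (auto simp: cyc_def successively_append_iff add_is_1)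

lemma sum_of_bool_le:
  assumes "finite A"
  shows "(\<Sum>r\<in>A. of_bool (P \<and> r = c)) \<le> (of_bool P :: nat)"
  using assms by (cases P) (simp_all add: of_bool_def)

text \<open>The degree sum is counted on \<open>q\<close>, on the rest of \<open>K\<close> and
  outside \<open>K\<close>. The bounds add up to
  \<open>2 * card V - 2 + length Q - length q\<close>, and \<open>Q\<close> is no longer than
  \<open>q\<close>.\<close>

lemma minimal_ear_deg:
  assumes dist: "distinct (Q @ G)" and K: "K = set (Q @ G)" "K \<subseteq> V" and Q: "Q \<noteq> []"
    and ear: "ear K (last Q) (p1 @ y # p2) (hd Q)"
    and min_gap: "\<And>v p'. v \<in> set G \<Longrightarrow> ear K (last Q) p' v \<or> ear K v p' (hd Q) \<Longrightarrow> y \<notin> set p'"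
    and out_tail: "\<And>u v w. p2 = u @ v # w \<Longrightarrow> E y v \<Longrightarrow> u = []" "E y (hd Q) \<Longrightarrow> p2 = []"
    and in_init: "\<And>u v w. p1 = u @ v # w \<Longrightarrow> E v y \<Longrightarrow> w = []" "E (last Q) y \<Longrightarrow> p1 = []"
    and no_ins_y: "successively (\<lambda>u v. \<not> (E u y \<and> E y v)) Q"
    and q: "distinct q" "set Q \<subseteq> set q" "set q \<subseteq> K"
    and no_ins_x: "successively (\<lambda>u v. \<not> (E u x \<and> E x v)) q"
    and x: "x \<in> set G" "x \<notin> set q"
  shows "\<not> adj x y" "deg x + deg y + 2 \<le> 2 * card V"
proof -
  let ?a = "last Q" and ?b = "hd Q"
  have ab: "?a \<in> K" "?b \<in> K" using Q K by auto
  have path: "successively E (?a # p1 @ [y])" "successively E (y # p2 @ [?b])"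
    and dp: "distinct (p1 @ y # p2)" "set (p1 @ y # p2) \<inter> K = {}"
    using ear by (auto simp: ear_def successively_append_iff successively_Cons hd_append split: if_splits)
  have y: "y \<in> V" "y \<notin> K"
    using path(2) dp arc_in_V by (auto simp: successively_Cons)
  have xK: "x \<in> K" using x K by auto
  have finK: "finite K" using K by simp
  have nonadj: "\<not> adj v y" if v: "v \<in> set G" for v
  proof
    assume "adj v y"
    then consider "E v y" | "E y v" by (auto simp: adj_def)
    then show False
    proof cases
      case 1
      then have "ear K v (y # p2) ?b" using path dp v K Q by (auto simp: ear_def)
      then show False using min_gap[OF v] by fastforce
    next
      case 2
      then have "ear K ?a (p1 @ [y]) v"
        using path dp v K Q by (auto simp: ear_def successively_append_iff successively_Cons hd_append)
      then show False using min_gap[OF v] by fastforce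
    qed
  qed
  then show "\<not> adj x y" using x by blast
  have xy: "x \<noteq> y" using xK y by auto

  \<comment> \<open>These units are the excess of the neighbours of \<open>y\<close> on the ear.
    They are regained on \<open>Q\<close>: by \<open>out_tail\<close> and \<open>in_init\<close>, a
    nonempty \<open>p2\<close> excludes the arc from \<open>y\<close> to \<open>?b\<close>, and a
    nonempty \<open>p1\<close> the arc from \<open>?a\<close> to \<open>y\<close>.\<close>
  let ?e1 = "of_bool (p2 \<noteq> []) :: nat" and ?e2 = "of_bool (p1 \<noteq> []) :: nat"
  have "q \<noteq> []" using q Q by auto
  have sum_q_x: "(\<Sum>v\<in>set q. link x v) \<le> length q + 1"
    using successively_count[OF no_ins_x \<open>q \<noteq> []\<close> q(1)] by (auto simp: of_bool_def split: if_splits)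
  have "(\<Sum>v\<in>set q. link y v) = (\<Sum>v\<in>set Q. link y v)"
  proof (rule sum.mono_neutral_right)
    show "\<forall>v\<in>set q - set Q. link y v = 0"
      using nonadj q K by (auto simp: adj_def)
  qed (use q in auto)
  moreover have "(\<Sum>v\<in>set Q. link y v) + 1 \<le> length Q + of_bool (E y ?b) + of_bool (E ?a y)"
    using successively_count[OF no_ins_y Q] dist by auto
  moreover have "of_bool (E y ?b) + ?e1 \<le> 1" "of_bool (E ?a y) + ?e2 \<le> 1"
    using out_tail(2) in_init(2) by auto
  ultimately have sum_q_y: "(\<Sum>v\<in>set q. link y v) + ?e1 + ?e2 \<le> length Q + 1"
    by linarith
  have "(\<Sum>v\<in>K - set q. link x v + link y v) \<le> 2 * card (K - set q - {x})"
  proof -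
    have "(\<Sum>v\<in>K - set q. link x v + link y v) = (\<Sum>v\<in>K - set q - {x}. link x v + link y v)"
      using finK nonadj x no_loop by (intro sum.mono_neutral_right) (auto simp: adj_def)
    also have "\<dots> \<le> (\<Sum>v\<in>K - set q - {x}. 2)"
    proof (rule sum_mono)
      fix v assume "v \<in> K - set q - {x}"
      then have "v \<in> set G" using K q by auto
      with nonadj have "link y v = 0" by (auto simp: adj_def)
      then show "link x v + link y v \<le> 2" by simp
    qed
    also have "\<dots> = 2 * card (K - set q - {x})" by simp
    finally show ?thesis .
  qed
  moreover have "card (K - set q) = Suc (card (K - set q - {x}))"
    using finK xK x by (intro card.remove) auto
  moreover have "card (K - set q) + length q = card K"
    using card_Diff_subset[OF finite_set q(3)] card_mono[OF finK q(3)] distinct_card[OF q(1)] by linarith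
  ultimately have sum_G: "(\<Sum>v\<in>K - set q. link x v + link y v) + 2 + 2 * length q \<le> 2 * card K"
    by linarith
  \<comment> \<open>A vertex off the ear that links \<open>x\<close> and \<open>y\<close> in either
    direction would give an ear with one end at \<open>x\<close>, that is, with a smaller gap. For
    the same reason a vertex of \<open>p2\<close> has no arc to \<open>x\<close> and a vertex of
    \<open>p1\<close> none from \<open>x\<close>, so only the neighbours of \<open>y\<close> on the
    ear can exceed two.\<close>
  have out: "link x r + link y r \<le>
      2 + (of_bool (p2 \<noteq> [] \<and> r = hd p2) + of_bool (p1 \<noteq> [] \<and> r = last p1))"
    if r: "r \<in> V - K - {y}" for r
  proof -
    have A: "r \<in> set p2" if "E x r" "E r y"
    proof (rule ccontr)
      assume "r \<notin> set p2"
      then have "ear K x (r # y # p2) ?b"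
        using that r path(2) dp ab xK by (auto simp: ear_def)
      then show False using min_gap[OF x(1)] by fastforce
    qed
    have B: "r \<in> set p1" if "E y r" "E r x"
    proof (rule ccontr)
      assume "r \<notin> set p1"
      then have "ear K ?a (p1 @ [y, r]) x"
        using that r path(1) dp ab xK
        by (auto simp: ear_def successively_append_iff successively_Cons hd_append)
      then show False using min_gap[OF x(1)] by fastforce
    qed
    have A': "\<not> E r x" if r2: "r \<in> set p2"
    proof
      assume "E r x"
      obtain u w where uw: "p2 = u @ r # w" using r2 by (meson in_set_conv_decomp)
      have "ear K ?a (p1 @ y # u @ [r]) x"
        using \<open>E r x\<close> ear xK uw
        by (auto simp: ear_def successively_append_iff successively_Cons hd_append split: if_splits)
      then show False using min_gap[OF x(1)] by fastforce
    qed
    have B': "\<not> E x r" if r1: "r \<in> set p1"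
    proof
      assume "E x r"
      obtain u w where uw: "p1 = u @ r # w" using r1 by (meson in_set_conv_decomp)
      have "ear K x (r # w @ y # p2) ?b"
        using \<open>E x r\<close> ear xK uw
        by (auto simp: ear_def successively_append_iff successively_Cons hd_append split: if_splits)
      then show False using min_gap[OF x(1)] by fastforce
    qed
    have A'': "p2 \<noteq> [] \<and> r = hd p2" if "r \<in> set p2" "E y r"
      using out_tail(1) that by (fastforce simp: in_set_conv_decomp)
    have B'': "p1 \<noteq> [] \<and> r = last p1" if "r \<in> set p1" "E r y"
      using in_init(1) that by (fastforce simp: in_set_conv_decomp)
    consider "r \<in> set p2" "r \<notin> set p1" | "r \<in> set p1" "r \<notin> set p2" | "r \<notin> set p1" "r \<notin> set p2"
      using dp by auto
    then show ?thesis
    proof cases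
      case 1
      with A' A'' show ?thesis by (cases "E y r") (auto simp: of_bool_def)
    next
      case 2
      with B' B'' show ?thesis by (cases "E r y") (auto simp: of_bool_def)
    next
      case 3
      with A B have "\<not> (E x r \<and> E r y)" "\<not> (E y r \<and> E r x)" by auto
      then show ?thesis by (auto simp: of_bool_def)
    qed
  qed
  have sum_R: "(\<Sum>v\<in>V - K. link x v + link y v) + 2 \<le> 2 * card (V - K) + ?e1 + ?e2"
  proof -
    let ?f = "\<lambda>r. of_bool (p2 \<noteq> [] \<and> r = hd p2) + of_bool (p1 \<noteq> [] \<and> r = last p1) :: nat"
    have "(\<Sum>v\<in>V - K. link x v + link y v) = (\<Sum>v\<in>V - K - {y}. link x v + link y v)"
      using finite_V nonadj x no_loop by (intro sum.mono_neutral_right) (auto simp: adj_def)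
    also have "\<dots> \<le> (\<Sum>v\<in>V - K - {y}. 2 + ?f v)"
      by (intro sum_mono out)
    also have "\<dots> = 2 * card (V - K - {y}) + sum ?f (V - K - {y})"
      unfolding sum.distrib[of "\<lambda>_. 2"] by simp
    finally have "(\<Sum>v\<in>V - K. link x v + link y v) \<le> 2 * card (V - K - {y}) + sum ?f (V - K - {y})" .
    moreover have "sum ?f (V - K - {y}) \<le> ?e1 + ?e2"
    proof -
      have fin: "finite (V - K - {y})" using finite_V by blast
      show ?thesis unfolding sum.distrib
        by (rule add_mono[OF sum_of_bool_le[OF fin] sum_of_bool_le[OF fin]])
    qed
    moreover have "card (V - K) = Suc (card (V - K - {y}))"
      using y finite_V by (intro card.remove) auto
    ultimately show ?thesis by linarith
  qed
  have "deg x + deg y = (\<Sum>v\<in>V. link x v + link y v)"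
    unfolding deg_sum by (simp add: sum.distrib)
  also have "\<dots> = (\<Sum>v\<in>V - K. link x v + link y v) + (\<Sum>v\<in>K. link x v + link y v)"
    by (intro sum.subset_diff finite_V K)
  also have "(\<Sum>v\<in>K. link x v + link y v)
      = (\<Sum>v\<in>K - set q. link x v + link y v) + ((\<Sum>v\<in>set q. link x v) + (\<Sum>v\<in>set q. link y v))"
    using q finK by (subst sum.subset_diff[of "set q"]) (auto simp: sum.distrib)
  finally have eq: "deg x + deg y = (\<Sum>v\<in>V - K. link x v + link y v) +
    ((\<Sum>v\<in>K - set q. link x v + link y v) + ((\<Sum>v\<in>set q. link x v) + (\<Sum>v\<in>set q. link y v)))" .
  have "length Q \<le> length q"
    using q dist by (metis card_mono distinct_append distinct_card finite_set)
  moreover have "card (V - K) + card K = card V"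
    using K finK finite_V by (metis card_Diff_subset card_mono le_add_diff_inverse2)
  ultimately show "deg x + deg y + 2 \<le> 2 * card V"
    using eq sum_R sum_G sum_q_x sum_q_y by linarith
qed

end

text \<open>The term \<open>+ 2\<close> on the larger side avoids truncated subtraction. Later
  \<open>V\<close> is the strong component that contains \<open>Y\<close>.\<close>

locale degree_set = strong_digraph +
  fixes Y :: "'a set"
  assumes Y_subset: "Y \<subseteq> V"
    and out_cond: "x \<in> Y \<Longrightarrow> y \<in> Y \<Longrightarrow> z \<in> Y \<Longrightarrow> x \<noteq> y \<Longrightarrow> x \<noteq> z \<Longrightarrow> y \<noteq> z \<Longrightarrow> \<not> adj x y \<Longrightarrow>
      \<not> E x z \<Longrightarrow> 3 * card V \<le> deg x + deg y + outd x + ind z + 2"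
    and in_cond: "x \<in> Y \<Longrightarrow> y \<in> Y \<Longrightarrow> z \<in> Y \<Longrightarrow> x \<noteq> y \<Longrightarrow> x \<noteq> z \<Longrightarrow> y \<noteq> z \<Longrightarrow> \<not> adj x y \<Longrightarrow>
      \<not> E z x \<Longrightarrow> 3 * card V \<le> deg x + deg y + ind x + outd z + 2"
begin

definition max_cyc :: "'a list \<Rightarrow> bool" where
  "max_cyc c \<longleftrightarrow> cyc c \<and> (\<forall>c'. cyc c' \<longrightarrow> card (Y \<inter> set c') \<le> card (Y \<inter> set c))"

definition bad :: "'a \<Rightarrow> 'a \<Rightarrow> bool" where
  "bad x y \<longleftrightarrow> x \<in> Y \<and> y \<in> Y \<and> x \<noteq> y \<and> \<not> adj x y \<and> deg x + deg y + 2 \<le> 2 * card V"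

lemma max_cyc_rotate: "max_cyc (xs @ ys) \<Longrightarrow> max_cyc (ys @ xs)"
  using cyc_rotate unfolding max_cyc_def by (auto simp: Un_commute)

lemma finite_Y: "finite Y" using Y_subset finite_V finite_subset by blast

lemma max_cyc_no_gain:
  assumes "max_cyc c" "cyc c'" "Y \<inter> set c \<subseteq> set c'" "y \<in> Y \<inter> set c'"
  shows "y \<in> set c"
proof (rule ccontr)
  assume "y \<notin> set c"
  then have "Y \<inter> set c \<subset> Y \<inter> set c'" using assms by auto
  then have "card (Y \<inter> set c) < card (Y \<inter> set c')"
    using finite_Y by (intro psubset_card_mono) auto
  then show False using assms unfolding max_cyc_def by fastforce
qed

text \<open>Among the ears through \<open>y\<close> with their end points in the gap \<open>G\<close> or at its boundary, one
  takes a smallest gap, then a shortest ear, and then a longest path \<open>q\<close> that contains \<open>Q\<close> and may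
  absorb vertices of the gap.\<close>

lemma ear_replacement:
  assumes "max_cyc (Q @ G)" "K = set (Q @ G)" "Q \<noteq> []" "ear K (last Q) p (hd Q)" "y \<in> Y" "y \<in> set p"
  shows "\<exists>a p b q. ear K a p b \<and> y \<in> set p \<and> cyc (q @ p) \<and> set q \<subseteq> K \<and>
    Y \<inter> set G - set q \<noteq> {} \<and> (\<forall>x\<in>Y \<inter> K - set q. bad x y)"
  using assms(1-4,6)
proof (induction "length G" arbitrary: Q G p rule: less_induct)
  case less
  show ?case
  proof (cases "\<exists>v p'. v \<in> set G \<and> y \<in> set p' \<and> (ear K (last Q) p' v \<or> ear K v p' (hd Q))")
    case True
    then obtain v p' where v: "v \<in> set G" "y \<in> set p'"
      and ears: "ear K (last Q) p' v \<or> ear K v p' (hd Q)" by blast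
    obtain G1 G2 where G: "G = G1 @ v # G2" using v by (meson in_set_conv_decomp)
    \<comment> \<open>An ear with one end at \<open>v\<close> spans only a part of the gap:
      \<open>G1\<close> or \<open>G2\<close> becomes the new gap, and the rest of the cycle, rotated
      if necessary, becomes the new \<open>Q\<close>.\<close>
    have "\<exists>Q' G'. length G' < length G \<and> max_cyc (Q' @ G') \<and> K = set (Q' @ G') \<and> Q' \<noteq> [] \<and>
      set G' \<subseteq> set G \<and> ear K (last Q') p' (hd Q')"
    proof (cases "ear K (last Q) p' v")
      case True
      have "max_cyc ((v # G2 @ Q) @ G1)"
        using max_cyc_rotate[of "Q @ G1" "v # G2"] less.prems G by simp
      then show ?thesis using G less.prems True
        by (intro exI[of _ "v # G2 @ Q"] exI[of _ G1]) auto
    next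
      case False
      then show ?thesis using G less.prems ears
        by (intro exI[of _ "Q @ G1 @ [v]"] exI[of _ G2]) auto
    qed
    then obtain Q' G' where Q': "length G' < length G" "max_cyc (Q' @ G')" "K = set (Q' @ G')"
      "Q' \<noteq> []" "set G' \<subseteq> set G" "ear K (last Q') p' (hd Q')" by blast
    from less.hyps[OF Q'(1,2,3,4,6) v(2)] Q'(5) show ?thesis by blast
  next
    case False
    then have min_gap: "\<And>v p'. v \<in> set G \<Longrightarrow> ear K (last Q) p' v \<or> ear K v p' (hd Q) \<Longrightarrow> y \<notin> set p'"
      by blast
    let ?a = "last Q" and ?b = "hd Q"
    have cyc: "cyc (Q @ G)" using less.prems unfolding max_cyc_def by simp
    then have dist: "distinct (Q @ G)" and KV: "K \<subseteq> V" and succ: "successively E Q"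
      using less.prems by (auto simp: cyc_def successively_append_iff)
    obtain p where p: "ear K ?a p ?b" "y \<in> set p"
      and pmin: "\<And>p'. ear K ?a p' ?b \<Longrightarrow> y \<in> set p' \<Longrightarrow> length p \<le> length p'"
      using ex_has_least_nat[of "\<lambda>p. ear K ?a p ?b \<and> y \<in> set p" p length] less.prems by blast
    obtain p1 p2 where p12: "p = p1 @ y # p2" using p by (meson in_set_conv_decomp)
    have yK: "y \<notin> K" and pV: "set p \<subseteq> V"
    proof -
      show "y \<notin> K" using p by (auto simp: ear_def)
      show "set p \<subseteq> V"
      proof
        fix v assume "v \<in> set p"
        then obtain u w where "p = u @ v # w" by (meson in_set_conv_decomp)
        then have "\<exists>t. E v t"
          using p(1) by (auto simp: ear_def successively_append_iff successively_Cons)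
        then show "v \<in> V" using arc_in_V by blast
      qed
    qed
    have out1: "u = []" if "p2 = u @ v # w" "E y v" for u v w
      using pmin[of "p1 @ y # v # w"] p(1) that p12
      by (auto simp: ear_def successively_append_iff successively_Cons hd_append split: if_splits)
    have out2: "p2 = []" if "E y ?b"
      using pmin[of "p1 @ [y]"] p(1) that p12
      by (auto simp: ear_def successively_append_iff successively_Cons hd_append split: if_splits)
    have in1: "w = []" if "p1 = u @ v # w" "E v y" for u v w
      using pmin[of "u @ v # y # p2"] p(1) that p12
      by (auto simp: ear_def successively_append_iff successively_Cons hd_append split: if_splits)
    have in2: "p1 = []" if "E ?a y"
      using pmin[of "y # p2"] p(1) that p12
      by (auto simp: ear_def successively_append_iff successively_Cons hd_append split: if_splits)
    \<comment> \<open>Inserting \<open>y\<close> between consecutive vertices of \<open>Q\<close>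
      would give a cycle with one more vertex of \<open>Y\<close>.\<close>
    have no_ins_y: "successively (\<lambda>u v. \<not> (E u y \<and> E y v)) Q"
    proof (rule ccontr)
      assume "\<not> ?thesis"
      then obtain u a b w where uw: "Q = u @ a # b # w" "E a y" "E y b"
        by (rule not_successively_split) auto
      then have "cyc ((u @ a # y # b # w) @ G)"
        using cyc yK less.prems arc_in_V
        by (auto simp: cyc_def successively_append_iff successively_Cons hd_append split: if_splits)
      from max_cyc_no_gain[OF less.prems(1) this, of y] uw yK less.prems \<open>y \<in> Y\<close> show False by auto
    qed
    \<comment> \<open>A longest such path cannot absorb \<open>x\<close>, as
      \<open>minimal_ear_deg\<close> requires. Its ends are fixed so that it closes up with the ear
      \<open>p\<close>.\<close>
    define S where "S q \<longleftrightarrow> distinct q \<and> q \<noteq> [] \<and> hd q = ?b \<and> last q = ?a \<and> successively E q \<and>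
      set Q \<subseteq> set q \<and> set q \<subseteq> K" for q
    have "S Q" using dist succ less.prems by (auto simp: S_def)
    moreover have "\<forall>q. S q \<longrightarrow> length q < Suc (card K)"
      using less.prems by (auto simp: S_def less_Suc_eq_le simp flip: distinct_card intro!: card_mono)
    ultimately obtain q where q: "S q" and qmax: "\<And>q'. S q' \<Longrightarrow> length q' \<le> length q"
      using ex_has_greatest_nat[of S Q length "Suc (card K)"] by (metis less_imp_le)
    have bad: "bad x y" if x: "x \<in> Y \<inter> K - set q" for x
    proof -
      have xG: "x \<in> set G" using x q less.prems by (auto simp: S_def)
      have "successively (\<lambda>u v. \<not> (E u x \<and> E x v)) q"
      proof (rule ccontr)
        assume "\<not> ?thesis"
        then obtain u a b w where uw: "q = u @ a # b # w" "E a x" "E x b"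
          by (rule not_successively_split) auto
        then have "S (u @ a # x # b # w)"
          using q x
          by (auto simp: S_def successively_append_iff successively_Cons hd_append split: if_splits)
        from qmax[OF this] uw show False by simp
      qed
      from minimal_ear_deg[OF dist less.prems(2) KV less.prems(3) p(1)[unfolded p12] min_gap
          out1 out2 in1 in2 no_ins_y _ _ _ this xG] q x
      have "\<not> adj x y" "deg x + deg y + 2 \<le> 2 * card V" by (auto simp: S_def)
      then show ?thesis using x yK \<open>y \<in> Y\<close> by (auto simp: bad_def)
    qed
    have "p \<noteq> []" using p by auto
    then have "E ?a (hd p)" "E (last p) ?b" "successively E p"
      using p(1) by (simp_all add: ear_def successively_append_iff successively_Cons)
    then have cyc': "cyc (q @ p)"
      using q p(1) pV KV \<open>p \<noteq> []\<close> unfolding cyc_def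
      by (auto simp: S_def ear_def successively_append_iff)
    have "Y \<inter> set G - set q \<noteq> {}"
    proof
      assume "Y \<inter> set G - set q = {}"
      then have "Y \<inter> set (Q @ G) \<subseteq> set (q @ p)" using q by (auto simp: S_def)
      from max_cyc_no_gain[OF less.prems(1) cyc' this, of y] \<open>y \<in> Y\<close> p yK less.prems show False by auto
    qed
    then show ?thesis using p cyc' bad q by (intro exI[of _ ?a] exI[of _ p] exI[of _ ?b] exI[of _ q]) (auto simp: S_def)
  qed
qed

end

section \<open>Vertices outside a maximal cycle\<close>

context degree_set
begin

lemma bad_sym: "bad x y \<Longrightarrow> bad y x"
  by (auto simp: bad_def adj_def add.commute)

text \<open>Both degree conditions apply to \<open>x, y, z\<close>. Their left-hand sides add up to
  \<open>2 * (deg x + deg y) + (deg x + deg z)\<close>, which is at most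
  \<open>6 * card V - 6\<close> for bad pairs but at least \<open>6 * card V - 4\<close> by the
  conditions.\<close>

lemma bad_unique:
  assumes "bad x y" "bad x z"
  shows "y = z"
proof (rule ccontr)
  assume "y \<noteq> z"
  then have "3 * card V \<le> deg x + deg y + outd x + ind z + 2"
    and "3 * card V \<le> deg x + deg y + ind x + outd z + 2"
    using assms out_cond[of x y z] in_cond[of x y z] by (auto simp: bad_def adj_def)
  moreover have "deg x + deg y + 2 \<le> 2 * card V" "deg x + deg z + 2 \<le> 2 * card V"
    using assms by (auto simp: bad_def)
  ultimately show False unfolding deg_def by linarith
qed

lemma bad_out:
  assumes "bad x y" "z \<in> Y" "z \<noteq> x" "z \<noteq> y" "\<not> E x z"
  shows "card V \<le> outd x + ind z"
proof -
  have "3 * card V \<le> deg x + deg y + outd x + ind z + 2"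
    using assms out_cond[of x y z] by (auto simp: bad_def)
  moreover have "deg x + deg y + 2 \<le> 2 * card V"
    using assms by (auto simp: bad_def)
  ultimately show ?thesis by linarith
qed

lemma bad_in:
  assumes "bad x y" "z \<in> Y" "z \<noteq> x" "z \<noteq> y" "\<not> E z x"
  shows "card V \<le> outd z + ind x"
proof -
  have "3 * card V \<le> deg x + deg y + ind x + outd z + 2"
    using assms in_cond[of x y z] by (auto simp: bad_def)
  moreover have "deg x + deg y + 2 \<le> 2 * card V"
    using assms by (auto simp: bad_def)
  ultimately show ?thesis by linarith
qed

lemma max_cyc_split:
  assumes "max_cyc c" "a \<in> set c" "b \<in> set c"
  obtains Q G where "max_cyc (Q @ G)" "set (Q @ G) = set c" "Q \<noteq> []" "hd Q = b" "last Q = a"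
proof -
  obtain u w where uw: "c = u @ b # w" using assms by (meson in_set_conv_decomp)
  then have c': "max_cyc (b # w @ u)" using max_cyc_rotate[of u "b # w"] assms by simp
  have "a \<in> set (b # w @ u)" using assms uw by auto
  then obtain s t where st: "b # w @ u = s @ a # t" by (meson in_set_conv_decomp)
  have "hd (s @ [a]) = b" using st by (cases s) auto
  moreover have "set (b # w @ u) = set c" using uw by auto
  ultimately show ?thesis
    using that[of "s @ [a]" t] c' st by simp
qed

lemma ear_gap_partner:
  assumes "max_cyc (Q @ G)" "Q \<noteq> []" "ear (set (Q @ G)) (last Q) p (hd Q)" "y \<in> Y" "y \<in> set p"
  shows "\<exists>x\<in>set G. bad x y"
  using ear_replacement[OF assms(1) refl assms(2-5)] by fastforce

lemma ear_partner:
  assumes c: "max_cyc c" and ear: "ear (set c) a p b" and y: "y \<in> Y" "y \<in> set p"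
  shows "\<exists>x\<in>set c - {a, b}. bad x y"
proof -
  have ab: "a \<in> set c" "b \<in> set c" using ear by (auto simp: ear_def)
  obtain Q G where QG: "max_cyc (Q @ G)" "set (Q @ G) = set c" "Q \<noteq> []" "hd Q = b" "last Q = a"
    using max_cyc_split[OF c ab] .
  then obtain x where x: "x \<in> set G" "bad x y"
    using ear_gap_partner[OF QG(1,3) _ y] ear by auto
  have "distinct (Q @ G)" using QG(1) unfolding max_cyc_def cyc_def by blast
  moreover have "a \<in> set Q" "b \<in> set Q" using QG(3-5) by auto
  ultimately have "x \<noteq> a" "x \<noteq> b" using x by auto
  then show ?thesis using x QG(2) by auto
qed

lemma max_cyc_subset: "max_cyc c \<Longrightarrow> set c \<subseteq> V"
  by (auto simp: max_cyc_def cyc_def)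

text \<open>Without an ear through \<open>y1\<close>, all of \<open>Y\<close> on the cycle would be bad partners of \<open>y1\<close>,
  among them the bad partner of \<open>y2\<close>.\<close>

lemma ex_ear:
  assumes c: "max_cyc c" and y: "y1 \<in> Y - set c" "y2 \<in> Y - set c" "y1 \<noteq> y2"
  shows "\<exists>a p b. ear (set c) a p b \<and> y1 \<in> set p"
proof (rule ccontr)
  assume no: "\<not> ?thesis"
  have none: "bad x y" if "y \<in> Y - set c" "\<nexists>a p b. ear (set c) a p b \<and> y \<in> set p" "x \<in> Y \<inter> set c" for x y
  proof -
    have "\<not> adj x y" "deg x + deg y + 2 \<le> 2 * card V"
      using no_ear[of "set c" x y] that max_cyc_subset[OF c] Y_subset by blast+
    then show ?thesis using that by (auto simp: bad_def)
  qed
  have "Y \<inter> set c \<noteq> {}"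
  proof
    assume empty: "Y \<inter> set c = {}"
    have "cyc [y1]" using y Y_subset by (auto simp: cyc_def)
    from max_cyc_no_gain[OF c this, of y1] empty y show False by auto
  qed
  then obtain x0 where x0: "x0 \<in> Y \<inter> set c" by blast
  obtain x where x: "x \<in> set c" "bad x y2"
  proof (cases "\<exists>a p b. ear (set c) a p b \<and> y2 \<in> set p")
    case True
    with ear_partner[OF c] y that show thesis by blast
  next
    case False
    with none[OF y(2) _ x0] x0 that show thesis by blast
  qed
  then have "bad x y1" using none[OF y(1) no] by (auto simp: bad_def)
  with x bad_unique y show False by blast
qed

text \<open>By uniqueness of bad partners, the new cycle loses exactly one vertex \<open>x\<close>
  of \<open>Y\<close> on the old one. It gains \<open>y1\<close>, so it is again maximal and leaves
  no room for \<open>y2\<close>.\<close>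

lemma replacement:
  assumes c: "max_cyc c" and y: "y1 \<in> Y - set c" "y2 \<in> Y - set c" "y1 \<noteq> y2"
  obtains x a p b q where "bad x y1" "x \<in> set c" "ear (set c) a p b" "y1 \<in> set p" "y2 \<notin> set p"
    "max_cyc (q @ p)" "x \<notin> set (q @ p)" "y2 \<notin> set (q @ p)"
proof -
  obtain a0 p0 b0 where e0: "ear (set c) a0 p0 b0" "y1 \<in> set p0"
    using ex_ear[OF assms] by blast
  then have ab: "a0 \<in> set c" "b0 \<in> set c" by (auto simp: ear_def)
  obtain Q G where QG: "max_cyc (Q @ G)" "set (Q @ G) = set c" "Q \<noteq> []" "hd Q = b0" "last Q = a0"
    using max_cyc_split[OF c ab] .
  have "y1 \<in> Y" using y by simp
  from ear_replacement[OF QG(1) QG(2)[symmetric] QG(3) _ this e0(2)] e0(1) QG(4,5)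
  obtain a p b q x where e: "ear (set c) a p b" "y1 \<in> set p" "cyc (q @ p)" "set q \<subseteq> set c"
    "x \<in> Y" "x \<in> set c" "x \<notin> set q" and bad: "\<And>z. z \<in> Y \<inter> set c - set q \<Longrightarrow> bad z y1"
    using QG(2) by fastforce
  have x: "bad x y1" using bad e by blast
  have "Y \<inter> set c - set q = {x}"
    using bad e bad_unique bad_sym x by blast
  then have sub: "insert y1 (Y \<inter> set c - {x}) \<subseteq> Y \<inter> set (q @ p)"
    using e y by auto
  have "card (Y \<inter> set c) = card (Y \<inter> set c - {x}) + 1"
    using e finite_Y unfolding Suc_eq_plus1[symmetric] by (intro card.remove) auto
  also have "\<dots> = card (insert y1 (Y \<inter> set c - {x}))"
    using finite_Y y by simp
  finally have card: "card (Y \<inter> set c) = card (insert y1 (Y \<inter> set c - {x}))" .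
  have max: "max_cyc (q @ p)"
    using c e(3) card card_mono[OF _ sub] finite_Y unfolding max_cyc_def by fastforce
  have "y2 \<notin> set p"
  proof
    assume "y2 \<in> set p"
    then have "insert y2 (insert y1 (Y \<inter> set c - {x})) \<subseteq> Y \<inter> set (q @ p)"
      using sub y by auto
    then have "card (insert y2 (insert y1 (Y \<inter> set c - {x}))) \<le> card (Y \<inter> set (q @ p))"
      using finite_Y by (intro card_mono) auto
    also have "\<dots> \<le> card (Y \<inter> set c)"
      using c e(3) by (auto simp: max_cyc_def)
    finally show False using card y finite_Y by simp
  qed
  moreover have "x \<notin> set p" using e by (auto simp: ear_def)
  ultimately show ?thesis
    using that[OF x e(6) e(1) e(2) _ max] e y by auto
qed

section \<open>Arcs between two missed vertices and their bad partners\<close>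

lemmas ear_simps = ear_def successively_append_iff successively_Cons hd_append

text \<open>The gap of the ear contains a bad partner of \<open>y\<close>, and uniqueness identifies
  it with \<open>x\<close>. The contradictions below come from ears that violate this.\<close>

lemma bad_not_endpoint:
  assumes "max_cyc c" "bad x y" "ear (set c) a p b" "y \<in> set p"
  shows "a \<noteq> x" "b \<noteq> x"
proof -
  have "y \<in> Y" using assms by (simp add: bad_def)
  from ear_partner[OF assms(1,3) this assms(4)] obtain z where "z \<in> set c - {a, b}" "bad z y" by blast
  moreover from this have "z = x" using assms(2) bad_unique bad_sym by blast
  ultimately show "a \<noteq> x" "b \<noteq> x" by auto
qed

text \<open>The first two arcs would produce an ear through \<open>y1\<close> ending at
  \<open>x1\<close> and an ear through \<open>y2\<close> starting at \<open>x2\<close>. If the last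
  two arcs were both absent, four mixed bounds would make the degree sum of the two bad pairs at
  least \<open>4 * card V\<close>, although it is at most \<open>4 * card V - 4\<close>.\<close>

lemma outside_arc:
  assumes c: "max_cyc c" and y: "y1 \<in> Y - set c" "y2 \<in> Y - set c" "y1 \<noteq> y2"
    and b1: "bad x1 y1" "x1 \<in> set c" and b2: "bad x2 y2" "x2 \<in> set c" and arc: "E y1 y2"
  shows "\<not> E y2 x1" "\<not> E x2 y1" "E x1 y2 \<or> E y1 x2"
proof -
  show n1: "\<not> E y2 x1"
  proof
    assume "E y2 x1"
    \<comment> \<open>An ear through \<open>y1\<close> that avoids \<open>y2\<close> can be cut
      after \<open>y1\<close> and continued through \<open>y2\<close>.\<close>
    obtain a p b where p: "ear (set c) a p b" "y1 \<in> set p" "y2 \<notin> set p"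
      using replacement[OF c y] by metis
    then obtain u w where "p = u @ y1 # w" by (meson in_set_conv_decomp)
    with p have "ear (set c) a (u @ [y1, y2]) x1"
      using \<open>E y2 x1\<close> arc y b1 by (auto simp: ear_simps split: if_splits)
    with bad_not_endpoint[OF c b1(1)] show False by fastforce
  qed
  show n2: "\<not> E x2 y1"
  proof
    assume "E x2 y1"
    obtain a p b where p: "ear (set c) a p b" "y2 \<in> set p" "y1 \<notin> set p"
      using replacement[OF c y(2,1) y(3)[symmetric]] by metis
    then obtain u w where "p = u @ y2 # w" by (meson in_set_conv_decomp)
    with p have "ear (set c) x2 (y1 # y2 # w) b"
      using \<open>E x2 y1\<close> arc y b2 by (auto simp: ear_simps split: if_splits)
    with bad_not_endpoint[OF c b2(1)] show False by fastforce
  qed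
  show "E x1 y2 \<or> E y1 x2"
  proof (rule ccontr)
    assume n: "\<not> ?thesis"
    have ne: "x1 \<noteq> x2" using b1 b2 y bad_unique by blast
    have *: "x1 \<noteq> y2" "x2 \<noteq> y1" "x1 \<in> Y" "x2 \<in> Y" "y1 \<in> Y" "y2 \<in> Y"
      using y b1 b2 by (auto simp: bad_def)
    have "card V \<le> outd x1 + ind y2" using bad_out[OF b1(1), of y2] * y n by auto
    moreover have "card V \<le> outd y1 + ind x2" using bad_out[OF bad_sym[OF b1(1)], of x2] * ne n by auto
    moreover have "card V \<le> outd y2 + ind x1" using bad_in[OF b1(1), of y2] * y n1 by auto
    moreover have "card V \<le> outd x2 + ind y1" using bad_in[OF bad_sym[OF b1(1)], of x2] * ne n2 by auto
    ultimately show False using b1(1) b2(1) unfolding bad_def deg_def by linarith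
  qed
qed

text \<open>Inclusion-exclusion outside \<open>K\<close>: both neighbourhoods avoid
  \<open>U\<close>, so they overlap in at least \<open>card U\<close> vertices, and the slack
  \<open>m\<close> on \<open>K\<close> adds to the overlap.\<close>

lemma card_common_outside_ge:
  assumes K: "K \<subseteq> V"
    and sub: "{v. E s v} - K \<subseteq> V - K - U" "{v. E v t} - K \<subseteq> V - K - U"
    and U: "U \<subseteq> V - K"
    and on_K: "card ({v. E s v} \<inter> K) + card ({v. E v t} \<inter> K) + m \<le> card K"
    and sum: "card V \<le> outd s + ind t"
  shows "m + card U \<le> card ({v. E s v \<and> E v t} - K)"
proof -
  let ?A = "{v. E s v} - K" and ?B = "{v. E v t} - K"
  have fin: "finite ?A" "finite ?B" "finite K" "finite U"
    using finite_out finite_in finite_subset[OF K finite_V] finite_subset[OF U] finite_V by auto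
  have "outd s = card ({v. E s v} \<inter> K) + card ?A"
    unfolding outd_def using card_Int_Diff[OF finite_out, of s K] by simp
  moreover have "ind t = card ({v. E v t} \<inter> K) + card ?B"
    unfolding ind_def using card_Int_Diff[OF finite_in, of t K] by simp
  moreover have "card ?A + card ?B = card (?A \<union> ?B) + card (?A \<inter> ?B)"
    using fin by (intro card_Un_Int) auto
  moreover have "card (?A \<union> ?B) \<le> card (V - K - U)"
    using sub finite_V by (intro card_mono) auto
  moreover have "card (V - K - U) + card U = card (V - K)"
    using U fin finite_V card_mono[of "V - K" U] by (simp add: card_Diff_subset)
  moreover have "card (V - K) + card K = card V"
    using K fin finite_V card_mono[of V K] by (simp add: card_Diff_subset)
  moreover have "?A \<inter> ?B = {v. E s v \<and> E v t} - K" by auto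
  ultimately show ?thesis using on_K sum by simp
qed

lemma no_arc_outside:
  assumes c: "max_cyc c" and y: "y1 \<in> Y - set c" "y2 \<in> Y - set c" "y1 \<noteq> y2"
  shows "\<not> E y1 y2"
proof
  assume arc: "E y1 y2"
  let ?K = "set c"
  obtain x1 where x1: "bad x1 y1" "x1 \<in> ?K" using replacement[OF c y] by metis
  obtain x2 where x2: "bad x2 y2" "x2 \<in> ?K" using replacement[OF c y(2,1) y(3)[symmetric]] by metis
  note out = outside_arc[OF c y x1 x2 arc]
  have ne: "x1 \<noteq> x2" using x1 x2 y bad_unique by blast
  have inY: "x1 \<noteq> y2" "x2 \<noteq> y1" "x1 \<in> Y" "x2 \<in> Y" "y1 \<in> Y" "y2 \<in> Y"
    and nonadj: "\<not> E x1 y1" "\<not> E y1 x1" "\<not> E x2 y2" "\<not> E y2 x2"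
    using y x1 x2 by (auto simp: bad_def adj_def)
  have KV: "?K \<subseteq> V" by (rule max_cyc_subset[OF c])
  have dist: "distinct c" "c \<noteq> []" using c by (auto simp: max_cyc_def cyc_def)
  have yV: "y1 \<in> V - ?K" "y2 \<in> V - ?K" using y Y_subset by auto
  \<comment> \<open>If \<open>y2 y1\<close> were an arc too, \<open>outside_arc\<close> with
    exchanged roles would exclude both alternatives of \<open>out(3)\<close>.\<close>
  have no_back: "\<not> E y2 y1"
    using outside_arc[OF c y(2,1) y(3)[symmetric] x2 x1] out(3) by blast
  \<comment> \<open>The ear \<open>[y1, y2]\<close> would have an empty gap, with no place for the
    bad partner of \<open>y1\<close>.\<close>
  have empty_gap: "False" if "max_cyc Q" "set Q = ?K" "E (last Q) y1" "E y2 (hd Q)" for Q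
  proof -
    have "Q \<noteq> []" using that(1) unfolding max_cyc_def cyc_def by blast
    then have "ear (set (Q @ [])) (last Q) [y1, y2] (hd Q)"
      using that(2-4) arc y last_in_set[OF \<open>Q \<noteq> []\<close>] hd_in_set[OF \<open>Q \<noteq> []\<close>] by (auto simp: ear_def)
    from ear_gap_partner[OF _ \<open>Q \<noteq> []\<close> this, of y1] that(1) y show False by auto
  qed
  have "successively (\<lambda>u v. \<not> (E u y1 \<and> E y2 v)) c"
  proof (rule ccontr)
    assume "\<not> ?thesis"
    then obtain u a b w where uw: "c = (u @ [a]) @ b # w" "E a y1" "E y2 b"
      by (rule not_successively_split) auto
    with empty_gap[of "(b # w) @ u @ [a]"] max_cyc_rotate[of "u @ [a]" "b # w"] c show False by auto
  qed
  \<comment> \<open>\<open>empty_gap\<close> also covers the closing arc of the cycle, so the two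
    boundary terms are not both one.\<close>
  from successively_count[OF this dist(2,1)] empty_gap[OF c refl]
  have "(\<Sum>v\<in>?K. of_bool (E v y1) + of_bool (E y2 v)) \<le> length c"
    by (auto simp: of_bool_def split: if_splits)
  then have "card ({v. E y2 v} \<inter> ?K) + card ({v. E v y1} \<inter> ?K) + 0 \<le> card ?K"
    using dist by (simp add: sum.distrib distinct_card Int_commute)
  \<comment> \<open>Neither \<open>y1\<close> nor \<open>y2\<close> is an out-neighbour of
    \<open>y2\<close> or an in-neighbour of \<open>y1\<close>, so both can be put into
    \<open>U\<close>.\<close>
  then have "0 + card {y1, y2} \<le> card ({v. E y2 v \<and> E v y1} - ?K)"
    using bad_in[OF x1(1)] bad_out[OF bad_sym[OF x1(1)]] bad_in[OF bad_sym[OF x1(1)], of y2]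
      y no_back yV no_loop inY arc_in_V
    by (intro card_common_outside_ge[OF KV]) auto
  then have Z: "2 \<le> card ({v. E y2 v \<and> E v y1} - ?K)" using y(3) by simp
  \<comment> \<open>With two candidates for \<open>w\<close>, one differs from \<open>z\<close>; the
    final ear needs distinct \<open>z\<close> and \<open>w\<close>.\<close>
  have pick: "\<exists>z w. z \<noteq> w \<and> z \<in> {v. E y2 v \<and> E v y1} - ?K \<and> w \<in> W"
    if "2 \<le> card W" for W :: "'a set"
  proof -
    obtain z where z: "z \<in> {v. E y2 v \<and> E v y1} - ?K"
      using Z by (metis card.empty ex_in_conv not_numeral_le_zero)
    have "\<not> W \<subseteq> {z}"
    proof
      assume "W \<subseteq> {z}"
      then have "card W \<le> card {z}" by (intro card_mono) simp_all
      with that show False by simp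
    qed
    then obtain w where w: "w \<in> W" "w \<noteq> z" by auto
    show ?thesis by (intro exI[of _ z] exI[of _ w] conjI z w w(2)[symmetric])
  qed
  obtain z0 where z0: "E y2 z0" "E z0 y1" "z0 \<notin> ?K"
    using pick[OF Z] by blast
  then have z0': "z0 \<noteq> y1" "z0 \<noteq> y2" using no_loop no_back by auto
  from out(3) show False
  proof
    assume a: "E y1 x2"
    \<comment> \<open>Such an arc would start an ear through \<open>y2\<close> that ends at its bad
      partner \<open>x2\<close>.\<close>
    have y2K: "v \<notin> ?K" if "E v y2" for v
    proof
      assume v: "v \<in> ?K"
      then have "ear ?K v [y2, z0, y1] x2"
        using that z0 z0' a x2 y by (auto simp: ear_def)
      with bad_not_endpoint[OF c x2(1)] show False by fastforce
    qed
    then have n: "\<not> E x1 y2" using x1 by blast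
    have "card ({v. E x1 v} \<inter> ?K) + card ({v. E v y2} \<inter> ?K) + 1 \<le> card ?K"
    proof -
      have "{v. E v y2} \<inter> ?K = {}" using y2K by blast
      moreover have "{v. E x1 v} \<inter> ?K \<subset> ?K" using x1 no_loop by blast
      ultimately show ?thesis using psubset_card_mono[of ?K "{v. E x1 v} \<inter> ?K"] by simp
    qed
    \<comment> \<open>The slack \<open>1\<close> is due to \<open>x1\<close>, which lies on the
      cycle but is no out-neighbour of itself.\<close>
    then have "1 + card {y2} \<le> card ({v. E x1 v \<and> E v y2} - ?K)"
      using bad_out[OF x1(1), of y2] n yV no_loop inY arc_in_V y(3)
      by (intro card_common_outside_ge[OF KV]) auto
    then have "2 \<le> card ({v. E x1 v \<and> E v y2} - ?K)" by simp
    from pick[OF this] obtain z w where zw: "z \<noteq> w" "E y2 z" "E z y1" "z \<notin> ?K"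
      "E x1 w" "E w y2" "w \<notin> ?K" by blast
    moreover from this have "w \<noteq> y1" "w \<noteq> y2" "z \<noteq> y1" "z \<noteq> y2" using no_loop no_back nonadj by auto
    ultimately have "ear ?K x1 [w, y2, z, y1] x2"
      using a x1 x2 y by (auto simp: ear_def)
    with bad_not_endpoint[OF c x1(1)] show False by fastforce
  next
    \<comment> \<open>Mirror image of the previous case: the additional vertex \<open>w\<close> now
      follows \<open>y1\<close> instead of preceding \<open>y2\<close>.\<close>
    assume a: "E x1 y2"
    have y1K: "v \<notin> ?K" if "E y1 v" for v
    proof
      assume v: "v \<in> ?K"
      then have "ear ?K x1 [y2, z0, y1] v"
        using that z0 z0' a x1 y by (auto simp: ear_def)
      with bad_not_endpoint[OF c x1(1)] show False by fastforce
    qed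
    then have n: "\<not> E y1 x2" using x2 by blast
    have "card ({v. E y1 v} \<inter> ?K) + card ({v. E v x2} \<inter> ?K) + 1 \<le> card ?K"
    proof -
      have "{v. E y1 v} \<inter> ?K = {}" using y1K by blast
      moreover have "{v. E v x2} \<inter> ?K \<subset> ?K" using x2 no_loop by blast
      ultimately show ?thesis using psubset_card_mono[of ?K "{v. E v x2} \<inter> ?K"] by simp
    qed
    then have "1 + card {y1} \<le> card ({v. E y1 v \<and> E v x2} - ?K)"
      using bad_out[OF bad_sym[OF x1(1)], of x2] n yV no_loop inY arc_in_V y(3) ne
      by (intro card_common_outside_ge[OF KV]) auto
    then have "2 \<le> card ({v. E y1 v \<and> E v x2} - ?K)" by simp
    from pick[OF this] obtain z w where zw: "z \<noteq> w" "E y2 z" "E z y1" "z \<notin> ?K"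
      "E y1 w" "E w x2" "w \<notin> ?K" by blast
    moreover from this have "w \<noteq> y1" "w \<noteq> y2" "z \<noteq> y1" "z \<noteq> y2" using no_loop no_back nonadj by auto
    ultimately have "ear ?K x1 [y2, z, y1, w] x2"
      using a x1 x2 y by (auto simp: ear_def)
    with bad_not_endpoint[OF c x1(1)] show False by fastforce
  qed
qed

text \<open>Exchanging \<open>y1\<close> with its bad partner \<open>x1\<close> yields a maximal cycle that misses \<open>x1\<close>
  and \<open>y2\<close>.\<close>

lemma no_arc_to_partner:
  assumes c: "max_cyc c" and y: "y1 \<in> Y - set c" "y2 \<in> Y - set c" "y1 \<noteq> y2" and x1: "bad x1 y1"
  shows "\<not> adj x1 y2"
proof -
  obtain x p q where x: "bad x y1" "x \<in> set c" "max_cyc (q @ p)" "x \<notin> set (q @ p)" "y2 \<notin> set (q @ p)"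
    using replacement[OF c y] by metis
  have "x = x1" using x x1 bad_unique bad_sym by blast
  then have "x1 \<in> Y - set (q @ p)" "y2 \<in> Y - set (q @ p)" "x1 \<noteq> y2"
    using x y by (auto simp: bad_def)
  with no_arc_outside[OF x(3)] show ?thesis unfolding adj_def by metis
qed

text \<open>With no arc between \<open>x1\<close> and \<open>y2\<close> or between \<open>x2\<close>
  and \<open>y1\<close>, four mixed bounds add up to at least \<open>4 * card V\<close>, while two
  bad pairs have degree sum at most \<open>4 * card V - 4\<close>.\<close>

lemma max_cyc_misses_one:
  assumes c: "max_cyc c"
  shows "card (Y - set c) \<le> 1"
proof (rule ccontr)
  assume "\<not> ?thesis"
  then obtain y1 y2 where y: "y1 \<in> Y - set c" "y2 \<in> Y - set c" "y1 \<noteq> y2"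
    using card_le_Suc0_iff_eq[of "Y - set c"] finite_Y by auto
  obtain x1 where x1: "bad x1 y1" "x1 \<in> set c" using replacement[OF c y] by metis
  obtain x2 where x2: "bad x2 y2" "x2 \<in> set c" using replacement[OF c y(2,1) y(3)[symmetric]] by metis
  have ne: "x1 \<noteq> x2" using x1 x2 y bad_unique by blast
  have *: "x1 \<noteq> y2" "x2 \<noteq> y1" "x1 \<in> Y" "x2 \<in> Y" "y1 \<in> Y" "y2 \<in> Y"
    using y x1 x2 by (auto simp: bad_def)
  have n: "\<not> E x1 y2" "\<not> E y2 x1" "\<not> E x2 y1" "\<not> E y1 x2"
    using no_arc_to_partner[OF c y x1(1)] no_arc_to_partner[OF c y(2,1) y(3)[symmetric] x2(1)]
    by (auto simp: adj_def)
  have "card V \<le> outd x1 + ind y2" "card V \<le> outd y2 + ind x1"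
    using bad_out[OF x1(1), of y2] bad_in[OF x1(1), of y2] * y n by auto
  moreover have "card V \<le> outd x2 + ind y1" "card V \<le> outd y1 + ind x2"
    using bad_out[OF x2(1), of y1] bad_in[OF x2(1), of y1] * y n by auto
  ultimately show False using x1(1) x2(1) unfolding bad_def deg_def by linarith
qed

section \<open>From a maximal cycle to a cycle of length at least two\<close>

lemma ex_max_cyc:
  assumes "Y \<noteq> {}"
  shows "\<exists>c. max_cyc c"
proof -
  obtain y where "cyc [y]" using assms Y_subset by (auto simp: cyc_def)
  then show ?thesis
    using ex_has_greatest_nat[of cyc "[y]" "\<lambda>c. card (Y \<inter> set c)" "Suc (card Y)"]
      card_mono[OF finite_Y, of "Y \<inter> _"]
    unfolding max_cyc_def by (metis Int_lower1 le_imp_less_Suc)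
qed

text \<open>A maximal cycle may be a single vertex; then any cycle of length at least two through
  that vertex misses no more of \<open>Y\<close>.\<close>

theorem almost_cyclable:
  assumes "card Y \<ge> 2"
  shows "\<exists>c. cyc c \<and> length c \<ge> 2 \<and> card (Y - set c) \<le> 1"
proof -
  have "Y \<noteq> {}" using assms by auto
  then obtain c where c: "max_cyc c" using ex_max_cyc by blast
  note one = max_cyc_misses_one[OF c]
  show ?thesis
  proof (cases "length c \<ge> 2")
    case True
    then show ?thesis using c one by (auto simp: max_cyc_def)
  next
    case False
    moreover have "c \<noteq> []" using c unfolding max_cyc_def cyc_def by blast
    ultimately obtain v where v: "c = [v]" by (cases c; cases "tl c") auto
    have "\<not> Y \<subseteq> {v}"
    proof
      assume "Y \<subseteq> {v}"
      then have "card Y \<le> card {v}" by (intro card_mono) simp_all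
      with assms show False by simp
    qed
    then obtain y where y: "y \<in> Y" "y \<noteq> v" by blast
    have vV: "v \<in> V" using max_cyc_subset[OF c] v by simp
    have "E\<^sup>*\<^sup>* v y" using strong vV y Y_subset by auto
    then obtain w where w: "E v w" using y by (metis converse_rtranclpE)
    then have wV: "w \<in> V" "w \<notin> {v}" using arc_in_V no_loop by auto
    \<comment> \<open>Since \<open>w\<close> is adjacent to \<open>v\<close>, \<open>no_ear\<close>
      yields an ear through \<open>w\<close>. Both of its ends are \<open>v\<close>, so it is a
      cycle through \<open>v\<close>.\<close>
    obtain a p b where p: "ear {v} a p b" "w \<in> set p"
    proof -
      have "\<exists>a p b. ear {v} a p b \<and> w \<in> set p"
        using no_ear(1)[of "{v}" v w] w wV vV by (auto simp: adj_def)
      then show thesis using that by blast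
    qed
    have "set p \<subseteq> V"
    proof
      fix u assume "u \<in> set p"
      then obtain s t where "p = s @ u # t" by (meson in_set_conv_decomp)
      then have "\<exists>t. E u t" using p(1) by (auto simp: ear_simps)
      then show "u \<in> V" using arc_in_V by blast
    qed
    then have "cyc (v # p)"
      using p vV by (cases "p = []") (auto simp: ear_simps cyc_def)
    moreover have "length (v # p) \<ge> 2" using p by (cases p) auto
    moreover have "card (Y - set (v # p)) \<le> 1"
    proof -
      have "card (Y - set (v # p)) \<le> card (Y - {v})"
        using finite_Y by (intro card_mono) auto
      then show ?thesis using one v by simp
    qed
    ultimately show ?thesis by blast
  qed
qed

end

section \<open>Reduction to the strong component of \<open>Y\<close>\<close>

lemma (in digraph) out_degree_eq: "out_degree G x = card {v. x \<rightarrow> v}"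
proof -
  have "inj_on (head G) (out_arcs G x)"
    using no_multi_arcs by (auto intro!: inj_onI simp: arc_to_ends_def)
  moreover have "head G ` out_arcs G x = {v. x \<rightarrow> v}"
    by (force simp: arcs_ends_conv)
  ultimately show ?thesis unfolding out_degree_def by (metis card_image)
qed

lemma (in digraph) in_degree_eq: "in_degree G x = card {v. v \<rightarrow> x}"
proof -
  have "inj_on (tail G) (in_arcs G x)"
    using no_multi_arcs by (auto intro!: inj_onI simp: arc_to_ends_def)
  moreover have "tail G ` in_arcs G x = {v. v \<rightarrow> x}"
    by (force simp: arcs_ends_conv)
  ultimately show ?thesis unfolding in_degree_def by (metis card_image)
qed

lemma (in wf_digraph) awalk_imp_rtranclp: "awalk x p y \<Longrightarrow> (\<lambda>u v. u \<rightarrow> v)\<^sup>*\<^sup>* x y"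
proof (induction p arbitrary: x)
  case (Cons e p)
  then have "x \<rightarrow> head G e" "awalk (head G e) p y"
    by (auto simp: awalk_Cons_iff arcs_ends_conv)
  with Cons.IH show ?case by (meson converse_rtranclp_into_rtranclp)
qed (simp add: awalk_Nil_iff)

lemma (in wf_digraph) successively_awalk:
  assumes "successively (\<lambda>u v. u \<rightarrow> v) (c @ [w])" "c \<noteq> []"
  shows "\<exists>p. awalk (hd c) p w \<and> map (tail G) p = c"
  using assms
proof (induction c)
  case (Cons x c)
  show ?case
  proof (cases "c = []")
    case True
    with Cons.prems obtain e where "e \<in> arcs G" "tail G e = x" "head G e = w"
      by (auto simp: arcs_ends_conv)
    then have "awalk x [e] w \<and> map (tail G) [e] = [x]" by (auto simp: awalk_def)
    with True show ?thesis by auto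
  next
    case False
    with Cons obtain p where p: "awalk (hd c) p w" "map (tail G) p = c"
      by (auto simp: successively_Cons)
    have "x \<rightarrow> hd c" using Cons.prems False by (auto simp: successively_Cons)
    then obtain e where "e \<in> arcs G" "tail G e = x" "head G e = hd c"
      by (auto simp: arcs_ends_conv)
    with p have "awalk x (e # p) w \<and> map (tail G) (e # p) = x # c"
      by (auto simp: awalk_Cons_iff)
    then show ?thesis by (metis list.sel(1))
  qed
qed simp

lemma (in wf_digraph) ex_cycle:
  assumes "c \<noteq> []" "distinct c" "successively (\<lambda>u v. u \<rightarrow> v) c" "last c \<rightarrow> hd c"
  shows "\<exists>p. cycle p \<and> cycle_verts G p = set c"
proof -
  have "successively (\<lambda>u v. u \<rightarrow> v) (c @ [hd c])"
    using assms by (auto simp: successively_append_iff)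
  then obtain p where p: "awalk (hd c) p (hd c)" "map (tail G) p = c"
    using successively_awalk assms(1) by blast
  then have "p \<noteq> []" using assms(1) by auto
  then have "head G (last p) = hd c" using p(1) by (metis awlast_if_cas awalk_def awalk_verts_conv last_snoc)
  then have "awalk_verts (hd c) p = c @ [hd c]"
    using p \<open>p \<noteq> []\<close> by (simp add: awalk_verts_conv)
  then have "distinct (tl (awalk_verts (hd c) p))"
    using assms(1,2) by (cases c) auto
  then have "cycle p" using p \<open>p \<noteq> []\<close> unfolding cycle_def by blast
  moreover have "cycle_verts G p = set c"
    using p(2) by (auto simp: cycle_verts_def simp flip: set_map)
  ultimately show ?thesis by blast
qed

section \<open>Strong components and the transfer of the degree condition\<close>

definition strong_comp :: "('a \<Rightarrow> 'a \<Rightarrow> bool) \<Rightarrow> 'a \<Rightarrow> 'a set" where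
  "strong_comp E y = {v. E\<^sup>*\<^sup>* y v \<and> E\<^sup>*\<^sup>* v y}"

definition induced_rel :: "('a \<Rightarrow> 'a \<Rightarrow> bool) \<Rightarrow> 'a set \<Rightarrow> 'a \<Rightarrow> 'a \<Rightarrow> bool" where
  "induced_rel E S u v \<longleftrightarrow> E u v \<and> u \<in> S \<and> v \<in> S"

text \<open>A path between two members stays in the component, since each of its vertices is
  reachable from \<open>y\<close> and reaches \<open>y\<close>.\<close>

lemma strong_comp_connected:
  assumes "u \<in> strong_comp E y" "v \<in> strong_comp E y"
  shows "(induced_rel E (strong_comp E y))\<^sup>*\<^sup>* u v"
proof -
  have "E\<^sup>*\<^sup>* u v" using assms unfolding strong_comp_def by auto
  then show ?thesis using assms(1)
  proof (induction rule: converse_rtranclp_induct)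
    case (step u w)
    then have "E\<^sup>*\<^sup>* y w" "E\<^sup>*\<^sup>* w y"
      using assms(2) unfolding strong_comp_def
      by (auto intro: rtranclp.rtrancl_into_rtrancl rtranclp_trans)
    then have "w \<in> strong_comp E y" unfolding strong_comp_def by blast
    with step show ?case
      by (intro converse_rtranclp_into_rtranclp[of _ u w]) (auto simp: induced_rel_def)
  qed simp
qed

text \<open>A vertex outside the component cannot be an out-neighbour of one of its vertices and an
  in-neighbour of another.\<close>

lemma strong_comp_card:
  fixes E :: "'a \<Rightarrow> 'a \<Rightarrow> bool"
  assumes "finite V" "\<And>u v. E u v \<Longrightarrow> u \<in> V \<and> v \<in> V" "S = strong_comp E y" "S \<subseteq> V" "x \<in> S" "z \<in> S"
  shows "card {v. E x v} + card {v. E v z} + card S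
    \<le> card {v. induced_rel E S x v} + card {v. induced_rel E S v z} + card V"
proof -
  let ?A = "{v. E x v} - S" and ?B = "{v. E v z} - S"
  have fin: "finite {v. E x v}" "finite {v. E v z}"
    by (rule finite_subset[OF _ assms(1)], use assms(2) in blast)+
  have "v \<in> S" if "E x v" "E v z" for v
  proof -
    have "E\<^sup>*\<^sup>* y x" "E\<^sup>*\<^sup>* z y" using assms unfolding strong_comp_def by auto
    then have "E\<^sup>*\<^sup>* y v" "E\<^sup>*\<^sup>* v y"
      using that by (auto intro: rtranclp.rtrancl_into_rtrancl converse_rtranclp_into_rtranclp)
    then show ?thesis using assms(3) unfolding strong_comp_def by blast
  qed
  then have "card ?A + card ?B = card (?A \<union> ?B)"
    using fin by (intro card_Un_disjoint[symmetric]) auto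
  also have "\<dots> \<le> card (V - S)"
    using assms(1,2) by (intro card_mono) auto
  finally have AB: "card ?A + card ?B \<le> card (V - S)" .
  have "card (V - S) + card S = card V"
    using card_Diff_subset[OF finite_subset[OF assms(4,1)] assms(4)] card_mono[OF assms(1,4)] by simp
  moreover have "{v. induced_rel E S x v} = {v. E x v} \<inter> S" "{v. induced_rel E S v z} = {v. E v z} \<inter> S"
    using assms by (auto simp: induced_rel_def)
  ultimately show ?thesis
    using AB card_Int_Diff[OF fin(1), of S] card_Int_Diff[OF fin(2), of S] by simp
qed

theorem mainTheorem1:
  fixes D :: "('a, 'b) pre_digraph" and Y :: "'a set"
  assumes "digraph D"
    and "card (verts D) \<ge> 4"
    and "Y \<subseteq> verts D"
    and "card Y \<ge> 2"
    and "strongly_connected_set D Y"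
    and "degree_condition D Y"
  shows "\<exists>c. pre_digraph.cycle D c \<and> card (Y - cycle_verts D c) \<le> 1"
proof -
  interpret digraph D by fact
  define E where "E u v \<longleftrightarrow> u \<rightarrow>\<^bsub>D\<^esub> v" for u v
  let ?V = "verts D"
  have E_V: "u \<in> ?V \<and> v \<in> ?V" if "E u v" for u v
    using that by (auto simp: E_def arcs_ends_conv)
  obtain y0 where y0: "y0 \<in> Y" using assms(4) by fastforce
  define S where "S = strong_comp E y0"
  define E' where "E' = induced_rel E S"
  have reach: "E\<^sup>*\<^sup>* x y" if "x \<in> Y" "y \<in> Y" for x y
  proof (cases "x = y")
    case False
    with that assms(5) obtain p where "apath x p y"
      unfolding strongly_connected_set_def by blast
    then show ?thesis using awalk_imp_rtranclp unfolding apath_def E_def by blast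
  qed simp
  have YS: "Y \<subseteq> S"
    using reach y0 unfolding S_def strong_comp_def by blast
  have SV: "S \<subseteq> ?V"
  proof
    fix v assume "v \<in> S"
    then have "E\<^sup>*\<^sup>* y0 v" unfolding S_def strong_comp_def by blast
    then show "v \<in> ?V" using y0 assms(3) E_V by (induction rule: rtranclp_induct) auto
  qed
  have E': "E' u v \<longleftrightarrow> E u v \<and> u \<in> S \<and> v \<in> S" for u v
    unfolding E'_def induced_rel_def ..
  have finS: "finite S" using finite_subset[OF SV] by simp
  have loop: "\<not> E u u" for u unfolding E_def using adj_not_same by blast
  interpret S: strong_digraph S E'
  proof
    show "E'\<^sup>*\<^sup>* u v" if "u \<in> S" "v \<in> S" for u v
      using strong_comp_connected that unfolding E'_def S_def by fast
  qed (use finS E' loop in auto)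
  have od: "out_degree D x = card {v. E x v}" and id: "in_degree D x = card {v. E v x}" for x
    unfolding E_def by (rule out_degree_eq, rule in_degree_eq)
  \<comment> \<open>With \<open>z = x\<close> this bounds the loss of a whole degree. Each condition
    has two whole degrees and one mixed pair, so it loses at most three per vertex outside
    \<open>S\<close>, exactly what the right-hand side loses.\<close>
  have drop: "out_degree D x + in_degree D z + card S \<le> S.outd x + S.ind z + card ?V"
    if "x \<in> Y" "z \<in> Y" for x z
    unfolding od id S.outd_def S.ind_def unfolding E'_def
    by (rule strong_comp_card[OF finite_verts E_V S_def SV]) (use that YS in auto)
  interpret S: degree_set S E' Y
  proof
    show "Y \<subseteq> S" by (rule YS)
    fix x y z
    assume xyz: "x \<in> Y" "y \<in> Y" "z \<in> Y" "x \<noteq> y" "x \<noteq> z" "y \<noteq> z" and n: "\<not> S.adj x y"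
    have "\<not> adjacent D x y"
      using n xyz YS unfolding S.adj_def adjacent_def E' E_def by blast
    then have cond:
      "\<not> E x z \<longrightarrow> degree D x + degree D y + out_degree D x + in_degree D z \<ge> 3 * card ?V - 2"
      "\<not> E z x \<longrightarrow> degree D x + degree D y + in_degree D x + out_degree D z \<ge> 3 * card ?V - 2"
      using assms(6) xyz unfolding degree_condition_def E_def by blast+
    note d = drop[OF xyz(1,1)] drop[OF xyz(2,2)]
    show "3 * card S \<le> S.deg x + S.deg y + S.outd x + S.ind z + 2" if "\<not> E' x z"
    proof -
      have "\<not> E x z" using that xyz YS by (auto simp: E')
      with cond(1) have "degree D x + degree D y + out_degree D x + in_degree D z + 2 \<ge> 3 * card ?V"
        by linarith
      then show ?thesis
        using d drop[OF xyz(1,3)] unfolding degree_def S.deg_def by linarith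
    qed
    show "3 * card S \<le> S.deg x + S.deg y + S.ind x + S.outd z + 2" if "\<not> E' z x"
    proof -
      have "\<not> E z x" using that xyz YS by (auto simp: E')
      with cond(2) have "degree D x + degree D y + in_degree D x + out_degree D z + 2 \<ge> 3 * card ?V"
        by linarith
      then show ?thesis
        using d drop[OF xyz(3,1)] unfolding degree_def S.deg_def by linarith
    qed
  qed
  obtain c where c: "S.cyc c" "length c \<ge> 2" "card (Y - set c) \<le> 1"
    using S.almost_cyclable[OF assms(4)] by blast
  have "successively (\<lambda>u v. u \<rightarrow>\<^bsub>D\<^esub> v) c"
    using c(1) unfolding S.cyc_def by (auto elim!: successively_mono simp: E' E_def)
  moreover have "last c \<rightarrow>\<^bsub>D\<^esub> hd c" "c \<noteq> []" "distinct c"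
    using c(1,2) unfolding S.cyc_def by (auto simp: E' E_def)
  ultimately show ?thesis using ex_cycle c(3) by metis
qed

end
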